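(* Let $n\geq 1$. If $\varphi\in G_\infty(n,\mathbb{C})$ is periodic, then $\varphi$ is conjugate to $\varphi_1$ in $G_\infty(n,\mathbb{C})$.
   Context: Every $\varphi\in \mathbb{C}[[x_1,\dots,x_n]]^n$ has a unique homogeneous decomposition $\varphi=\sum_{k=0}^\infty\varphi_k$, where $\varphi_k$ is an $n$-tuple of homogeneous polynomials of degree $k$. $G_\infty(n,\mathbb{C})$ is the set of all $\varphi\in \mathbb{C}[[x_1,\dots,x_n]]^n$ with $\varphi_0=0$ and $\varphi_1\in GL_n(\mathbb{C})$ (an $n$-tuple of linear forms $\left(\sum_j a_{1j}x_j,\dots,\sum_j a_{nj}x_j\right)$ is identified with the matrix $(a_{ij})$). It is a group under composition $\varphi\phi=\varphi\circ\phi=(f_1(\phi),\dots,f_n(\phi))$ for $\varphi=(f_1,\dots,f_n)$, with identity $id=(x_1,\dots,x_n)$. A series is periodic if its order in this group is finite. Two elements $g_1,g_2$ of a group $G$ are conjugate if $g_1h=hg_2$ for some $h\in G$. *)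

theory Defs
  imports "HOL-Analysis.Analysis" "HOL-Algebra.Multiplicative_Group"
begin

section \<open>Formal power series in finitely many variables\<close>

text \<open>
  The variables are indexed by a finite type \<open>'n\<close>.  A monomial is its exponent vector,
  of type \<^typ>\<open>nat ^ 'n\<close>.
\<close>

typedef ('a, 'n::finite) mfps = "UNIV :: (nat ^ 'n \<Rightarrow> 'a) set"
  morphisms mfps_nth Abs_mfps
  by simp

lemma mfps_nth_Abs [simp]: "mfps_nth (Abs_mfps f) a = f a"
  by (simp add: Abs_mfps_inverse)

lemma mfps_eq_iff: "f = g \<longleftrightarrow> (\<forall>a. mfps_nth f a = mfps_nth g a)"
  by (simp add: mfps_nth_inject [symmetric] fun_eq_iff)

lemma mfps_eqI: "(\<And>a. mfps_nth f a = mfps_nth g a) \<Longrightarrow> f = g"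
  by (simp add: mfps_eq_iff)

definition mdeg :: "nat ^ 'n \<Rightarrow> nat" where
  "mdeg a = (\<Sum>i\<in>UNIV. a $ i)"

lemma mdeg_zero [simp]: "mdeg (0 :: nat ^ 'n) = 0"
  by (simp add: mdeg_def)

lemma mdeg_eq_0_iff [simp]: "mdeg a = 0 \<longleftrightarrow> a = 0"
  by (simp add: mdeg_def vec_eq_iff)

lemma mdeg_add [simp]: "mdeg (a + b) = mdeg a + mdeg b"
  by (simp add: mdeg_def sum.distrib)

lemma mdeg_axis [simp]: "mdeg (axis j k) = k"
  by (simp add: mdeg_def axis_def)

lemma finite_mdeg_le: "finite {a :: nat ^ 'n. mdeg a \<le> k}"
proof (rule finite_subset)
  show "{a :: nat ^ 'n. mdeg a \<le> k} \<subseteq> vec_lambda ` (UNIV \<rightarrow>\<^sub>E {..k})"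
  proof
    fix a :: "nat ^ 'n"
    assume "a \<in> {a. mdeg a \<le> k}"
    then have le: "a $ i \<le> k" for i
      using member_le_sum [of i UNIV "($) a"] by (simp add: mdeg_def)
    have "a = vec_lambda (($) a)"
      by (simp add: vec_eq_iff)
    moreover have "($) a \<in> UNIV \<rightarrow>\<^sub>E {..k}"
      using le by auto
    ultimately show "a \<in> vec_lambda ` (UNIV \<rightarrow>\<^sub>E {..k})"
      by blast
  qed
qed (intro finite_imageI finite_PiE; simp)

lemma finite_decompositions: "finite {(b, c). b + c = (a :: nat ^ 'n)}"
  by (rule finite_subset [OF _ finite_cartesian_product
        [OF finite_mdeg_le [of "mdeg a"] finite_mdeg_le [of "mdeg a"]]]) auto

instantiation mfps :: (comm_ring_1, finite) comm_ring_1
begin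

definition "0 = Abs_mfps (\<lambda>a. 0)"
definition "1 = Abs_mfps (\<lambda>a. if a = 0 then 1 else 0)"
definition "f + g = Abs_mfps (\<lambda>a. mfps_nth f a + mfps_nth g a)"
definition "f - g = Abs_mfps (\<lambda>a. mfps_nth f a - mfps_nth g a)"
definition "- f = Abs_mfps (\<lambda>a. - mfps_nth f a)"
definition "f * g = Abs_mfps (\<lambda>a. \<Sum>(b, c) | b + c = a. mfps_nth f b * mfps_nth g c)"

lemma mfps_nth_simps [simp]:
  fixes f g :: "('a, 'b) mfps"
  shows "mfps_nth (0 :: ('a, 'b) mfps) a = 0"
    and "mfps_nth (1 :: ('a, 'b) mfps) a = (if a = 0 then 1 else 0)"
    and "mfps_nth (f + g) a = mfps_nth f a + mfps_nth g a"
    and "mfps_nth (f - g) a = mfps_nth f a - mfps_nth g a"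
    and "mfps_nth (- f) a = - mfps_nth f a"
  by (simp_all add: zero_mfps_def one_mfps_def plus_mfps_def minus_mfps_def uminus_mfps_def)

lemma mfps_nth_mult:
  fixes f g :: "('a, 'b) mfps"
  shows "mfps_nth (f * g) a = (\<Sum>(b, c) | b + c = a. mfps_nth f b * mfps_nth g c)"
  by (simp add: times_mfps_def)

instance
proof
  fix f g h :: "('a, 'b) mfps"
  show "f * g * h = f * (g * h)"
  proof (rule mfps_eqI)
    fix a :: "nat ^ 'b"
    let ?D = "\<lambda>a :: nat ^ 'b. {p. fst p + snd p = a}"
    have D: "{(b, c). b + c = a} = ?D a" for a by auto
    have fin: "finite (?D a)" for a
      using finite_decompositions [of a] by (simp add: D)
    have "mfps_nth (f * g * h) a =
        (\<Sum>p\<in>?D a. \<Sum>q\<in>?D (fst p).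
          mfps_nth f (fst q) * mfps_nth g (snd q) * mfps_nth h (snd p))"
      by (simp add: mfps_nth_mult D case_prod_unfold sum_distrib_right)
    also have "\<dots> = (\<Sum>(p, q)\<in>Sigma (?D a) (\<lambda>p. ?D (fst p)).
          mfps_nth f (fst q) * mfps_nth g (snd q) * mfps_nth h (snd p))"
      by (subst sum.Sigma) (use fin in auto)
    also have "\<dots> = (\<Sum>(p, q)\<in>Sigma (?D a) (\<lambda>p. ?D (snd p)).
          mfps_nth f (fst p) * (mfps_nth g (fst q) * mfps_nth h (snd q)))"
      by (rule sum.reindex_bij_witness
          [where i = "\<lambda>(p, q). ((fst p + fst q, snd q), (fst p, fst q))"
             and j = "\<lambda>(p, q). ((fst q, snd q + snd p), (snd q, snd p))"])
        (auto simp: algebra_simps)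
    also have "\<dots> = (\<Sum>p\<in>?D a. \<Sum>q\<in>?D (snd p).
          mfps_nth f (fst p) * (mfps_nth g (fst q) * mfps_nth h (snd q)))"
      by (subst sum.Sigma) (use fin in auto)
    also have "\<dots> = mfps_nth (f * (g * h)) a"
      by (simp add: mfps_nth_mult D case_prod_unfold sum_distrib_left)
    finally show "mfps_nth (f * g * h) a = mfps_nth (f * (g * h)) a" .
  qed
  show "f * g = g * f"
  proof (rule mfps_eqI)
    fix a :: "nat ^ 'b"
    show "mfps_nth (f * g) a = mfps_nth (g * f) a"
      unfolding mfps_nth_mult
      by (rule sum.reindex_bij_witness [where i = prod.swap and j = prod.swap])
        (auto simp: algebra_simps)
  qed
  show "1 * f = f"
  proof (rule mfps_eqI)
    fix a :: "nat ^ 'b"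
    have "mfps_nth (1 * f) a = (\<Sum>(b, c)\<in>{(0, a)}. mfps_nth 1 b * mfps_nth f c)"
      unfolding mfps_nth_mult
      by (rule sum.mono_neutral_right)
        (use finite_decompositions [of a] in \<open>auto split: if_splits\<close>)
    then show "mfps_nth (1 * f) a = mfps_nth f a"
      by simp
  qed
  show "(f + g) * h = f * h + g * h"
    by (rule mfps_eqI)
      (simp add: mfps_nth_mult distrib_right case_prod_unfold sum.distrib)
  show "(0 :: ('a, 'b) mfps) \<noteq> 1"
    by (auto simp: mfps_eq_iff)
qed (auto intro!: mfps_eqI)

end

definition mfps_X :: "'n \<Rightarrow> ('a::comm_ring_1, 'n::finite) mfps" where
  "mfps_X j = Abs_mfps (\<lambda>a. if a = axis j 1 then 1 else 0)"


section \<open>Tuples of power series\<close>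

type_synonym ('a, 'n) mfps_tuple = "('a, 'n) mfps ^ 'n"

definition homogeneous_part ::
    "nat \<Rightarrow> ('a::comm_ring_1, 'n::finite) mfps_tuple \<Rightarrow> ('a, 'n) mfps_tuple" where
  "homogeneous_part k \<phi> =
     (\<chi> i. Abs_mfps (\<lambda>a. if mdeg a = k then mfps_nth (\<phi> $ i) a else 0))"

text \<open>The matrix identified with a tuple of linear forms: its entry at \<open>i\<close>, \<open>j\<close> is the
  coefficient of the variable with index \<open>j\<close> in the \<open>i\<close>-th component.\<close>

definition linear_matrix :: "('a::comm_ring_1, 'n::finite) mfps_tuple \<Rightarrow> 'a ^ 'n ^ 'n" where
  "linear_matrix \<phi> = (\<chi> i j. mfps_nth (\<phi> $ i) (axis j 1))"

text \<open>
  Substitution of \<open>\<phi>\<close> into \<open>f = (\<Sum>b. f\<^sub>b x\<^sup>b)\<close>, for \<open>\<phi>\<close> without constant term.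
  Then \<open>\<phi>\<^sup>b = (\<Prod>i. \<phi>\<^sub>i ^ b\<^sub>i)\<close> has no terms of degree below \<^term>\<open>mdeg b\<close>, so only the
  finitely many \<open>b\<close> with \<^prop>\<open>mdeg b \<le> mdeg a\<close> contribute to the coefficient at \<open>a\<close>.
\<close>

definition mfps_subst ::
    "('a::comm_ring_1, 'n::finite) mfps \<Rightarrow> ('a, 'n) mfps_tuple \<Rightarrow> ('a, 'n) mfps" where
  "mfps_subst f \<phi> = Abs_mfps (\<lambda>a. \<Sum>b | mdeg b \<le> mdeg a.
     mfps_nth f b * mfps_nth (\<Prod>i\<in>UNIV. (\<phi> $ i) ^ (b $ i)) a)"

definition tuple_compose ::
    "('a::comm_ring_1, 'n::finite) mfps_tuple \<Rightarrow> ('a, 'n) mfps_tuple \<Rightarrow> ('a, 'n) mfps_tuple" where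
  "tuple_compose \<phi> \<psi> = (\<chi> i. mfps_subst (\<phi> $ i) \<psi>)"

definition G_infty :: "('a::field, 'n::finite) mfps_tuple monoid" where
  "G_infty =
     \<lparr>carrier = {\<phi>. homogeneous_part 0 \<phi> = 0 \<and>
                     invertible (linear_matrix (homogeneous_part 1 \<phi>))},
      mult = tuple_compose,
      one = (\<chi> i. mfps_X i)\<rparr>"

text \<open>The library's order of a group element is \<open>0\<close> exactly if no positive power of the
  element is the identity, i.e. if its order is infinite.\<close>

definition periodic :: "('a::field, 'n::finite) mfps_tuple \<Rightarrow> bool" where
  "periodic \<phi> \<longleftrightarrow> group.ord G_infty \<phi> \<noteq> 0"

definition conjugate_in :: "('g, 'b) monoid_scheme \<Rightarrow> 'g \<Rightarrow> 'g \<Rightarrow> bool" where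
  "conjugate_in G x y \<longleftrightarrow> x \<in> carrier G \<and> y \<in> carrier G \<and>
     (\<exists>h\<in>carrier G. x \<otimes>\<^bsub>G\<^esub> h = h \<otimes>\<^bsub>G\<^esub> y)"

end

theory Submission
  imports Defs
begin

text \<open>
  Let \<open>m\<close> be the order of \<open>\<phi>\<close> and \<open>l = \<phi>\<^sub>1\<close>.  Taking linear parts is a homomorphism, so \<open>l\<^sup>m = id\<close> and
  each \<open>u\<^sub>k = l\<^bsup>-k\<^esup> \<phi>\<^sup>k\<close> has linear part \<open>id\<close>.  The sum \<open>h = u\<^sub>0 + \<dots> + u\<^bsub>m-1\<^esub>\<close> has the linear part
  \<open>m \<cdot> id\<close>, which is invertible in characteristic 0.  Composition is additive on the left, and on the
  right if the left factor is linear, so \<open>u\<^sub>k \<phi> = l u\<^bsub>k+1\<^esub>\<close> and \<open>u\<^sub>m = u\<^sub>0\<close> give \<open>h \<phi> = l h\<close>.  The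
  conjugating element is the inverse of \<open>h\<close>.
\<close>

section \<open>Coefficients and orders of vanishing\<close>

lemma mfps_nth_sum [simp]:
  "mfps_nth (\<Sum>x\<in>S. f x) a = (\<Sum>x\<in>S. mfps_nth (f x) a)"
  by (induction S rule: infinite_finite_induct) auto

text \<open>Scalars are embedded as constant series, so that scalar multiples are products in the
  ring of series.\<close>

definition mfps_const :: "'a::comm_ring_1 \<Rightarrow> ('a, 'n::finite) mfps" where
  "mfps_const c = Abs_mfps (\<lambda>a. if a = 0 then c else 0)"

lemma mfps_nth_const_mult [simp]:
  fixes f :: "('a::comm_ring_1, 'n::finite) mfps"
  shows "mfps_nth (mfps_const c * f) a = c * mfps_nth f a"
proof -
  have "mfps_nth (mfps_const c * f) a =
      (\<Sum>(b, d)\<in>{(0 :: nat ^ 'n, a)}. mfps_nth (mfps_const c) b * mfps_nth f d)"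
    unfolding mfps_nth_mult
    by (rule sum.mono_neutral_right)
      (use finite_decompositions [of a] in \<open>auto simp: mfps_const_def split: if_splits\<close>)
  then show ?thesis
    by (simp add: mfps_const_def)
qed

lemma mfps_nth_const [simp]: "mfps_nth (mfps_const c) a = (if a = 0 then c else 0)"
  by (simp add: mfps_const_def)

lemma mfps_const_simps:
  "mfps_const 1 = 1" "mfps_const 0 = 0"
  "mfps_const (c + d) = mfps_const c + mfps_const d"
  "mfps_const (c * d) = mfps_const c * mfps_const d"
  by (auto intro!: mfps_eqI)

lemma mfps_const_sum: "mfps_const (\<Sum>x\<in>S. f x) = (\<Sum>x\<in>S. mfps_const (f x))"
  by (auto intro!: mfps_eqI)

lemma mfps_nth_X: "mfps_nth (mfps_X j) a = (if a = axis j 1 then 1 else 0)"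
  by (simp add: mfps_X_def)

text \<open>Membership in the \<open>d\<close>-th power of the ideal generated by the variables; the
  approximations below are taken with respect to this filtration.\<close>

definition vanishes_below :: "nat \<Rightarrow> ('a::comm_ring_1, 'n::finite) mfps \<Rightarrow> bool" where
  "vanishes_below d f \<longleftrightarrow> (\<forall>a. mdeg a < d \<longrightarrow> mfps_nth f a = 0)"

lemma vanishes_below_0 [simp]: "vanishes_below 0 f"
  by (simp add: vanishes_below_def)

lemma vanishes_below_zero [simp]: "vanishes_below d 0"
  by (simp add: vanishes_below_def)

lemma vanishes_below_mono: "vanishes_below d f \<Longrightarrow> e \<le> d \<Longrightarrow> vanishes_below e f"
  by (auto simp: vanishes_below_def)

lemma vanishes_below_add: "vanishes_below d f \<Longrightarrow> vanishes_below d g \<Longrightarrow> vanishes_below d (f + g)"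
  by (auto simp: vanishes_below_def)

lemma vanishes_below_diff: "vanishes_below d f \<Longrightarrow> vanishes_below d g \<Longrightarrow> vanishes_below d (f - g)"
  by (auto simp: vanishes_below_def)

lemma vanishes_below_sum:
  "(\<And>x. x \<in> S \<Longrightarrow> vanishes_below d (f x)) \<Longrightarrow> vanishes_below d (\<Sum>x\<in>S. f x)"
  by (auto simp: vanishes_below_def)

lemma vanishes_below_mult:
  assumes "vanishes_below d f" "vanishes_below e g"
  shows "vanishes_below (d + e) (f * g)"
  unfolding vanishes_below_def
proof (intro allI impI)
  fix a :: "nat ^ 'b"
  assume a: "mdeg a < d + e"
  have "mfps_nth f b * mfps_nth g c = 0" if "b + c = a" for b c
  proof -
    have "mdeg b < d \<or> mdeg c < e"
      using a that by auto
    then show ?thesis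
      using assms by (auto simp: vanishes_below_def)
  qed
  then show "mfps_nth (f * g) a = 0"
    unfolding mfps_nth_mult by (intro sum.neutral) auto
qed

text \<open>The powers of the ideal meet in zero, so an identity may be checked modulo each of
  them.\<close>

lemma mfps_eq_if_vanishes: "(\<And>d. vanishes_below d (f - g)) \<Longrightarrow> f = g"
  by (rule mfps_eqI) (auto simp: vanishes_below_def)

text \<open>The forms of degree \<open>d\<close> coincide and nothing lies below them. These forms
  may be zero, so \<open>d\<close> is only a lower bound for the order.\<close>

definition same_leading ::
    "nat \<Rightarrow> ('a::comm_ring_1, 'n::finite) mfps \<Rightarrow> ('a, 'n) mfps \<Rightarrow> bool" where
  "same_leading d f g \<longleftrightarrow>
     vanishes_below d f \<and> vanishes_below d g \<and> vanishes_below (Suc d) (f - g)"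

lemma same_leading_1 [simp]: "same_leading 0 1 1"
  by (simp add: same_leading_def)

text \<open>By the telescoping \<open>f * g - f' * g' = (f - f') * g + f' * (g - g')\<close>, where
  the difference in each summand gains one degree.\<close>

lemma same_leading_mult:
  assumes "same_leading d f f'" "same_leading e g g'"
  shows "same_leading (d + e) (f * g) (f' * g')"
proof -
  have "f * g - f' * g' = (f - f') * g + f' * (g - g')"
    by (simp add: algebra_simps)
  moreover have "vanishes_below (Suc d + e) ((f - f') * g)"
    "vanishes_below (d + Suc e) (f' * (g - g'))"
    using assms by (auto simp: same_leading_def intro!: vanishes_below_mult simp del: add_Suc add_Suc_right)
  ultimately show ?thesis
    using assms by (simp add: same_leading_def vanishes_below_mult vanishes_below_add)
qed

lemma same_leading_power:
  "same_leading 1 f g \<Longrightarrow> same_leading k (f ^ k) (g ^ k)"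
  by (induction k) (auto dest: same_leading_mult)

lemma same_leading_prod:
  assumes "finite S" "\<And>i. i \<in> S \<Longrightarrow> same_leading (d i) (f i) (g i)"
  shows "same_leading (\<Sum>i\<in>S. d i) (\<Prod>i\<in>S. f i) (\<Prod>i\<in>S. g i)"
  using assms by (induction S rule: finite_induct) (auto intro: same_leading_mult)

section \<open>Substitution\<close>

text \<open>The monomial with exponent vector \<open>b\<close> evaluated at \<psi>; it names the
  product inside \<open>mfps_subst\<close>.\<close>

definition tuple_power :: "('a::comm_ring_1, 'n::finite) mfps_tuple \<Rightarrow> nat ^ 'n \<Rightarrow> ('a, 'n) mfps" where
  "tuple_power \<psi> b = (\<Prod>i\<in>UNIV. (\<psi> $ i) ^ (b $ i))"

lemma tuple_power_0 [simp]: "tuple_power \<psi> 0 = 1"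
  by (simp add: tuple_power_def)

lemma tuple_power_add: "tuple_power \<psi> (b + c) = tuple_power \<psi> b * tuple_power \<psi> c"
  by (simp add: tuple_power_def power_add prod.distrib)

lemma tuple_power_axis [simp]: "tuple_power \<psi> (axis j 1) = \<psi> $ j"
proof -
  have "tuple_power \<psi> (axis j 1) = (\<Prod>i\<in>{j}. (\<psi> $ i) ^ (axis j 1 $ i))"
    unfolding tuple_power_def by (rule prod.mono_neutral_right) (auto simp: axis_def)
  then show ?thesis
    by simp
qed

definition no_constant :: "('a::comm_ring_1, 'n::finite) mfps_tuple \<Rightarrow> bool" where
  "no_constant \<psi> \<longleftrightarrow> (\<forall>i. vanishes_below 1 (\<psi> $ i))"

text \<open>The form of degree \<open>mdeg b\<close> in \<open>tuple_power \<psi> b\<close> is the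
  monomial evaluated at the linear part of \<psi>, and the last hypothesis makes the linear parts
  agree.\<close>

lemma same_leading_tuple_power:
  assumes "no_constant \<psi>" "no_constant \<psi>'" "\<And>i. vanishes_below 2 (\<psi> $ i - \<psi>' $ i)"
  shows "same_leading (mdeg b) (tuple_power \<psi> b) (tuple_power \<psi>' b)"
  unfolding tuple_power_def mdeg_def
  using assms
  by (intro same_leading_prod same_leading_power)
    (auto simp: same_leading_def no_constant_def numeral_2_eq_2)

lemma vanishes_below_tuple_power:
  "no_constant \<psi> \<Longrightarrow> vanishes_below (mdeg b) (tuple_power \<psi> b)"
  using same_leading_tuple_power [of \<psi> \<psi> b] by (simp add: same_leading_def)

lemma mfps_nth_subst:
  "mfps_nth (mfps_subst f \<psi>) a =
     (\<Sum>b | mdeg b \<le> mdeg a. mfps_nth f b * mfps_nth (tuple_power \<psi> b) a)"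
  by (simp add: mfps_subst_def tuple_power_def)

text \<open>Exponents with \<open>mdeg b > mdeg a\<close> contribute nothing at \<open>a\<close>. So
  the cutoff, which varies with \<open>a\<close> in the definition, becomes uniform: one finite sum
  serves for all degrees up to \<open>d\<close>.\<close>

lemma mfps_nth_subst_le:
  assumes "no_constant \<psi>" "mdeg a \<le> d"
  shows "mfps_nth (mfps_subst f \<psi>) a =
     mfps_nth (\<Sum>b | mdeg b \<le> d. mfps_const (mfps_nth f b) * tuple_power \<psi> b) a"
proof -
  have "(\<Sum>b | mdeg b \<le> d. mfps_nth f b * mfps_nth (tuple_power \<psi> b) a) =
    (\<Sum>b | mdeg b \<le> mdeg a. mfps_nth f b * mfps_nth (tuple_power \<psi> b) a)"
    by (rule sum.mono_neutral_right)
      (use assms vanishes_below_tuple_power [OF assms(1)] finite_mdeg_le in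
        \<open>auto simp: vanishes_below_def not_le\<close>)
  then show ?thesis
    by (simp add: mfps_nth_subst)
qed

lemma vanishes_below_subst_approx:
  assumes "no_constant \<psi>"
  shows "vanishes_below (Suc d) (mfps_subst f \<psi> -
     (\<Sum>b | mdeg b \<le> d. mfps_const (mfps_nth f b) * tuple_power \<psi> b))"
  unfolding vanishes_below_def using mfps_nth_subst_le [OF assms, of _ d f] by auto

section \<open>Substitution as a ring homomorphism\<close>

lemma mfps_subst_add: "mfps_subst (f + g) \<psi> = mfps_subst f \<psi> + mfps_subst g \<psi>"
  by (rule mfps_eqI) (simp add: mfps_nth_subst distrib_right sum.distrib)

lemma mfps_subst_diff: "mfps_subst (f - g) \<psi> = mfps_subst f \<psi> - mfps_subst g \<psi>"
  by (rule mfps_eqI) (simp add: mfps_nth_subst left_diff_distrib sum_subtractf)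

lemma mfps_subst_0 [simp]: "mfps_subst 0 \<psi> = 0"
  by (rule mfps_eqI) (simp add: mfps_nth_subst)

lemma mfps_subst_sum: "mfps_subst (\<Sum>x\<in>S. f x) \<psi> = (\<Sum>x\<in>S. mfps_subst (f x) \<psi>)"
  by (induction S rule: infinite_finite_induct) (auto simp: mfps_subst_add)

lemma mfps_subst_const_mult: "mfps_subst (mfps_const c * f) \<psi> = mfps_const c * mfps_subst f \<psi>"
  by (rule mfps_eqI) (simp add: mfps_nth_subst sum_distrib_left mult.assoc)

lemma mfps_subst_1 [simp]: "mfps_subst 1 \<psi> = 1"
proof (rule mfps_eqI)
  fix a
  have "mfps_nth (mfps_subst 1 \<psi>) a = (\<Sum>b\<in>{0}. mfps_nth 1 b * mfps_nth (tuple_power \<psi> b) a)"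
    unfolding mfps_nth_subst
    by (rule sum.mono_neutral_right) (auto simp: finite_mdeg_le)
  then show "mfps_nth (mfps_subst 1 \<psi>) a = mfps_nth 1 a"
    by simp
qed

lemma vanishes_below_subst:
  assumes "no_constant \<psi>" "vanishes_below d f"
  shows "vanishes_below d (mfps_subst f \<psi>)"
  unfolding vanishes_below_def mfps_nth_subst
  using assms(2) by (auto simp: vanishes_below_def intro!: sum.neutral)

text \<open>Up to degree \<open>mdeg a\<close> both factors may be replaced by finite sums
  \<open>F\<close> and \<open>G\<close>; for these the claim reduces to
  \<open>tuple_power_add\<close>.\<close>

lemma mfps_subst_mult:
  fixes f g :: "('a::comm_ring_1, 'n::finite) mfps"
  assumes "no_constant \<psi>"
  shows "mfps_subst (f * g) \<psi> = mfps_subst f \<psi> * mfps_subst g \<psi>"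
proof (rule mfps_eqI)
  fix a :: "nat ^ 'n"
  define d where "d = mdeg a"
  define B where "B = {b :: nat ^ 'n. mdeg b \<le> d}"
  define F where "F = (\<Sum>b\<in>B. mfps_const (mfps_nth f b) * tuple_power \<psi> b)"
  define G where "G = (\<Sum>b\<in>B. mfps_const (mfps_nth g b) * tuple_power \<psi> b)"
  define t where "t = (\<lambda>(b, c). mfps_nth f b * mfps_nth g c * mfps_nth (tuple_power \<psi> (b + c)) a)"
  have fin: "finite B"
    unfolding B_def by (rule finite_mdeg_le)
  have "mfps_nth (mfps_subst (f * g) \<psi>) a = (\<Sum>b\<in>B. \<Sum>p | fst p + snd p = b. t p)"
    by (auto simp: mfps_nth_subst mfps_nth_mult B_def d_def sum_distrib_right t_def
        case_prod_unfold intro!: sum.cong)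
  \<comment> \<open>The fibres of addition over \<open>B\<close> are disjoint, so this is one sum
    over all pairs whose sum lies in \<open>B\<close>.\<close>
  also have "\<dots> = (\<Sum>p\<in>(\<Union>b\<in>B. {p. fst p + snd p = b}). t p)"
    by (rule sum.UNION_disjoint [symmetric])
      (use fin finite_decompositions in \<open>auto simp: case_prod_unfold\<close>)
  also have "\<dots> = (\<Sum>p\<in>B \<times> B. t p)"
  proof (rule sum.mono_neutral_left)
    \<comment> \<open>The added pairs have \<open>mdeg (b + c) > mdeg a\<close>, so the
      corresponding power of \<psi> has no term at \<open>a\<close>.\<close>
    show "\<forall>p\<in>B \<times> B - (\<Union>b\<in>B. {p. fst p + snd p = b}). t p = 0"
      using vanishes_below_tuple_power [OF assms]
      by (auto simp: t_def B_def d_def vanishes_below_def not_le)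
  qed (use fin in \<open>auto simp: B_def\<close>)
  also have "\<dots> = mfps_nth (F * G) a"
  proof -
    have "F * G = (\<Sum>(b, c)\<in>B \<times> B.
        mfps_const (mfps_nth f b * mfps_nth g c) * tuple_power \<psi> (b + c))"
      by (simp add: F_def G_def sum_product sum.cartesian_product tuple_power_add
          mfps_const_simps algebra_simps)
    then show ?thesis
      by (simp add: t_def case_prod_unfold)
  qed
  also have "\<dots> = mfps_nth (mfps_subst f \<psi> * mfps_subst g \<psi>) a"
  proof -
    have "vanishes_below (Suc d) (mfps_subst f \<psi> - F)" "vanishes_below (Suc d) (mfps_subst g \<psi> - G)"
      unfolding F_def G_def B_def by (rule vanishes_below_subst_approx [OF assms])+
    \<comment> \<open>The other factor enters with the trivial bound 0. The two products telescope
      to the difference between the full and the truncated product.\<close>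
    then have "vanishes_below (Suc d + 0) ((mfps_subst f \<psi> - F) * mfps_subst g \<psi>)"
      "vanishes_below (0 + Suc d) (F * (mfps_subst g \<psi> - G))"
      by (intro vanishes_below_mult; simp)+
    then have "vanishes_below (Suc d) ((mfps_subst f \<psi> - F) * mfps_subst g \<psi> + F * (mfps_subst g \<psi> - G))"
      by (simp add: vanishes_below_add)
    then have "mfps_nth ((mfps_subst f \<psi> - F) * mfps_subst g \<psi> + F * (mfps_subst g \<psi> - G)) a = 0"
      unfolding vanishes_below_def d_def by blast
    moreover have "(mfps_subst f \<psi> - F) * mfps_subst g \<psi> + F * (mfps_subst g \<psi> - G) =
        mfps_subst f \<psi> * mfps_subst g \<psi> - F * G"
      by (simp add: algebra_simps)
    ultimately show ?thesis
      by simp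
  qed
  finally show "mfps_nth (mfps_subst (f * g) \<psi>) a = mfps_nth (mfps_subst f \<psi> * mfps_subst g \<psi>) a" .
qed

lemma mfps_subst_power:
  "no_constant \<psi> \<Longrightarrow> mfps_subst (f ^ k) \<psi> = mfps_subst f \<psi> ^ k"
  by (induction k) (auto simp: mfps_subst_mult)

lemma mfps_subst_prod:
  "no_constant \<psi> \<Longrightarrow> mfps_subst (\<Prod>x\<in>S. f x) \<psi> = (\<Prod>x\<in>S. mfps_subst (f x) \<psi>)"
  by (induction S rule: infinite_finite_induct) (auto simp: mfps_subst_mult)

lemma mfps_subst_tuple_power:
  "no_constant \<psi> \<Longrightarrow> mfps_subst (tuple_power \<phi> b) \<psi> = tuple_power (tuple_compose \<phi> \<psi>) b"
  by (simp add: tuple_power_def mfps_subst_prod mfps_subst_power tuple_compose_def)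

section \<open>Composition of tuples\<close>

lemma no_constant_compose:
  "no_constant \<phi> \<Longrightarrow> no_constant \<psi> \<Longrightarrow> no_constant (tuple_compose \<phi> \<psi>)"
  unfolding no_constant_def [of \<phi>] no_constant_def [of "tuple_compose \<phi> \<psi>"]
  by (simp add: tuple_compose_def vanishes_below_subst)

text \<open>For the truncation \<open>F\<close> of \<open>mfps_subst f \<phi>\<close> the identity
  is the homomorphism property; the remainder vanishes below \<open>Suc d\<close>, and substituting
  \<psi> preserves this.\<close>

lemma mfps_subst_compose:
  assumes "no_constant \<phi>" "no_constant \<psi>"
  shows "mfps_subst (mfps_subst f \<phi>) \<psi> = mfps_subst f (tuple_compose \<phi> \<psi>)"
proof (rule mfps_eq_if_vanishes)
  fix d
  define F where "F = (\<Sum>b | mdeg b \<le> d. mfps_const (mfps_nth f b) * tuple_power \<phi> b)"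
  have "vanishes_below (Suc d) (mfps_subst f \<phi> - F)"
    unfolding F_def by (rule vanishes_below_subst_approx [OF assms(1)])
  then have 1: "vanishes_below (Suc d) (mfps_subst (mfps_subst f \<phi>) \<psi> - mfps_subst F \<psi>)"
    unfolding mfps_subst_diff [symmetric] by (rule vanishes_below_subst [OF assms(2)])
  have "mfps_subst F \<psi> = (\<Sum>b | mdeg b \<le> d. mfps_const (mfps_nth f b) *
      tuple_power (tuple_compose \<phi> \<psi>) b)"
    by (simp add: F_def mfps_subst_sum mfps_subst_const_mult mfps_subst_tuple_power assms)
  then have 2: "vanishes_below (Suc d) (mfps_subst f (tuple_compose \<phi> \<psi>) - mfps_subst F \<psi>)"
    using vanishes_below_subst_approx [OF no_constant_compose [OF assms]] by simp
  show "vanishes_below d (mfps_subst (mfps_subst f \<phi>) \<psi> - mfps_subst f (tuple_compose \<phi> \<psi>))"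
    using vanishes_below_mono [OF vanishes_below_diff [OF 1 2], of d] by simp
qed

lemma tuple_compose_assoc:
  "no_constant \<psi> \<Longrightarrow> no_constant \<eta> \<Longrightarrow>
    tuple_compose (tuple_compose \<phi> \<psi>) \<eta> = tuple_compose \<phi> (tuple_compose \<psi> \<eta>)"
  unfolding tuple_compose_def [of _ \<eta>] tuple_compose_def [of \<phi>]
  by (simp add: mfps_subst_compose vec_eq_iff) (simp add: tuple_compose_def)

section \<open>Linear parts\<close>

lemma mdeg_eq_1_iff: "mdeg (b :: nat ^ 'n::finite) = 1 \<longleftrightarrow> (\<exists>j. b = axis j 1)"
proof
  assume "mdeg b = 1"
  then obtain j where j: "b $ j = 1" "\<And>i. i \<noteq> j \<Longrightarrow> b $ i = 0"
    unfolding mdeg_def by (auto simp: sum_eq_Suc0_iff)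
  then have "b = axis j 1"
    by (auto simp: vec_eq_iff axis_def)
  then show "\<exists>j. b = axis j 1" ..
qed auto

lemma range_axis_1: "range (\<lambda>j. axis j 1) = {b :: nat ^ 'n::finite. mdeg b = 1}"
  by (auto simp only: mdeg_eq_1_iff)

lemma mfps_subst_linear:
  fixes f :: "('a::comm_ring_1, 'n::finite) mfps"
  assumes "no_constant \<psi>" "\<And>b. mdeg b \<noteq> 1 \<Longrightarrow> mfps_nth f b = 0"
  shows "mfps_subst f \<psi> = (\<Sum>j\<in>UNIV. mfps_const (mfps_nth f (axis j 1)) * \<psi> $ j)"
proof (rule mfps_eqI)
  fix a :: "nat ^ 'n"
  let ?t = "\<lambda>b. mfps_nth f b * mfps_nth (tuple_power \<psi> b) a"
  \<comment> \<open>The cutoff is raised by one so that it admits degree 1 even for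
    \<open>a = 0\<close>.\<close>
  have "mfps_nth (mfps_subst f \<psi>) a = (\<Sum>b | mdeg b \<le> Suc (mdeg a). ?t b)"
    using mfps_nth_subst_le [OF assms(1), of a "Suc (mdeg a)" f] by simp
  also have "\<dots> = (\<Sum>b\<in>range (\<lambda>j. axis j 1). ?t b)"
    unfolding range_axis_1
    by (rule sum.mono_neutral_right) (use assms(2) finite_mdeg_le in auto)
  also have "\<dots> = (\<Sum>j\<in>UNIV. ?t (axis j 1))"
    by (subst sum.reindex) (auto simp: inj_def axis_eq_axis)
  finally show "mfps_nth (mfps_subst f \<psi>) a =
      mfps_nth (\<Sum>j\<in>UNIV. mfps_const (mfps_nth f (axis j 1)) * \<psi> $ j) a"
    by (simp add: tuple_power_axis del: One_nat_def)
qed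

section \<open>Linear tuples and matrices\<close>

definition linear_tuple :: "'a::comm_ring_1 ^ 'n ^ 'n \<Rightarrow> ('a, 'n::finite) mfps_tuple" where
  "linear_tuple A = (\<chi> i. \<Sum>j\<in>UNIV. mfps_const (A $ i $ j) * mfps_X j)"

lemma axis_1_eq_iff: "axis i (1::nat) = axis j 1 \<longleftrightarrow> i = j"
  by (auto simp: axis_eq_axis)

lemma mfps_nth_linear_tuple_axis:
  "mfps_nth (linear_tuple A $ i) (axis j 1) = A $ i $ j"
proof -
  have "mfps_nth (linear_tuple A $ i) (axis j 1) = (\<Sum>k\<in>UNIV. if j = k then A $ i $ k else 0)"
    unfolding linear_tuple_def mfps_nth_sum vec_lambda_beta mfps_nth_const_mult mfps_nth_X axis_1_eq_iff
    by (rule sum.cong) auto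
  then show ?thesis
    by simp
qed

lemma mfps_nth_linear_tuple_other:
  "mdeg a \<noteq> 1 \<Longrightarrow> mfps_nth (linear_tuple A $ i) a = 0"
  by (auto simp: linear_tuple_def mfps_nth_X intro!: sum.neutral)

lemma no_constant_linear_tuple [simp]: "no_constant (linear_tuple A)"
  unfolding no_constant_def vanishes_below_def by (auto intro: mfps_nth_linear_tuple_other)

lemma linear_matrix_linear_tuple [simp]: "linear_matrix (linear_tuple A) = A"
  by (simp add: linear_matrix_def vec_eq_iff mfps_nth_linear_tuple_axis del: One_nat_def)

lemma homogeneous_part_1: "homogeneous_part 1 \<phi> = linear_tuple (linear_matrix \<phi>)"
proof -
  have "mfps_nth (homogeneous_part 1 \<phi> $ i) a = mfps_nth (linear_tuple (linear_matrix \<phi>) $ i) a" for i a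
  proof (cases "mdeg a = 1")
    case True
    then obtain j where "a = axis j 1"
      using mdeg_eq_1_iff by blast
    then show ?thesis
      unfolding homogeneous_part_def
      by (simp add: mfps_nth_linear_tuple_axis linear_matrix_def del: One_nat_def)
  next
    case False
    then show ?thesis
      by (simp add: homogeneous_part_def mfps_nth_linear_tuple_other)
  qed
  then show ?thesis
    by (simp add: vec_eq_iff mfps_eq_iff)
qed

lemma linear_tuple_one:
  "linear_tuple (mat 1) = ((\<chi> i. mfps_X i) :: ('a::comm_ring_1, 'n::finite) mfps_tuple)"
proof -
  have "(\<Sum>j\<in>UNIV. mfps_const (mat 1 $ i $ j) * mfps_X j) =
      (\<Sum>j\<in>UNIV. if i = j then mfps_X j else (0 :: ('a, 'n) mfps))" for i
    by (rule sum.cong) (auto simp: mat_def mfps_const_simps)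
  then show ?thesis
    unfolding linear_tuple_def by (simp only: sum.delta' finite UNIV_I if_True)
qed

text \<open>On the left, a linear tuple acts as a constant matrix on the vector of components; this
  is the source of additivity in the right argument.\<close>

lemma linear_tuple_compose:
  assumes "no_constant \<psi>"
  shows "tuple_compose (linear_tuple A) \<psi> = (\<chi> i. \<Sum>j\<in>UNIV. mfps_const (A $ i $ j) * \<psi> $ j)"
proof -
  have "mfps_subst (linear_tuple A $ i) \<psi> = (\<Sum>j\<in>UNIV. mfps_const (A $ i $ j) * \<psi> $ j)" for i
    using mfps_subst_linear [OF assms mfps_nth_linear_tuple_other, of A i]
    unfolding mfps_nth_linear_tuple_axis .
  then show ?thesis
    by (simp add: tuple_compose_def)
qed

lemma linear_tuple_1_compose:
  assumes "no_constant \<psi>"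
  shows "tuple_compose (linear_tuple (mat 1)) \<psi> = \<psi>"
proof -
  have "(\<Sum>j\<in>UNIV. mfps_const (mat 1 $ i $ j) * \<psi> $ j) = (\<Sum>j\<in>UNIV. if i = j then \<psi> $ j else 0)"
    for i
    by (rule sum.cong) (auto simp: mat_def mfps_const_simps)
  then show ?thesis
    by (simp add: linear_tuple_compose [OF assms] vec_eq_iff)
qed

text \<open>Chain rule at the origin: in degree 1 only exponents with \<open>mdeg b \<le> 1\<close>
  count, the vanishing constant term of \<phi> disposes of \<open>b = 0\<close>, and the power for
  \<open>axis k 1\<close> is the component \<open>\<psi> $ k\<close>.\<close>

lemma linear_matrix_compose:
  fixes \<phi> \<psi> :: "('a::comm_ring_1, 'n::finite) mfps_tuple"
  assumes "no_constant \<phi>" "no_constant \<psi>"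
  shows "linear_matrix (tuple_compose \<phi> \<psi>) = linear_matrix \<phi> ** linear_matrix \<psi>"
proof -
  have "mfps_nth (mfps_subst (\<phi> $ i) \<psi>) (axis j 1) =
      (\<Sum>k\<in>UNIV. mfps_nth (\<phi> $ i) (axis k 1) * mfps_nth (\<psi> $ k) (axis j 1))" for i j
  proof -
    let ?t = "\<lambda>b. mfps_nth (\<phi> $ i) b * mfps_nth (tuple_power \<psi> b) (axis j 1)"
    have "mfps_nth (mfps_subst (\<phi> $ i) \<psi>) (axis j 1) = (\<Sum>b | mdeg b \<le> 1. ?t b)"
      by (simp add: mfps_nth_subst)
    also have "\<dots> = (\<Sum>b\<in>range (\<lambda>k. axis k 1). ?t b)"
    proof (rule sum.mono_neutral_right)
      show "\<forall>b\<in>{b. mdeg b \<le> 1} - range (\<lambda>k. axis k 1). ?t b = 0"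
      proof
        fix b :: "nat ^ 'n"
        assume "b \<in> {b. mdeg b \<le> 1} - range (\<lambda>k. axis k 1)"
        then have "mdeg b < 1"
          unfolding range_axis_1 mem_Collect_eq Diff_iff by linarith
        then show "?t b = 0"
          using assms(1) by (auto simp: no_constant_def vanishes_below_def)
      qed
    qed (auto simp: finite_mdeg_le)
    also have "\<dots> = (\<Sum>k\<in>UNIV. ?t (axis k 1))"
      by (subst sum.reindex) (auto simp: inj_def axis_eq_axis)
    finally show ?thesis
      by (simp del: One_nat_def)
  qed
  then show ?thesis
    by (simp add: linear_matrix_def tuple_compose_def matrix_matrix_mult_def)
qed

lemma linear_tuple_mult:
  "tuple_compose (linear_tuple A) (linear_tuple B) = linear_tuple (A ** B)"
proof -
  have "(\<Sum>j\<in>UNIV. mfps_const (A $ i $ j) * (\<Sum>k\<in>UNIV. mfps_const (B $ j $ k) * mfps_X k)) =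
    (\<Sum>k\<in>UNIV. mfps_const (\<Sum>j\<in>UNIV. A $ i $ j * B $ j $ k) * mfps_X k)" for i
    unfolding sum_distrib_left mfps_const_sum sum_distrib_right mfps_const_simps mult.assoc
    by (rule sum.swap)
  then show ?thesis
    by (simp add: linear_tuple_compose) (simp add: linear_tuple_def matrix_matrix_mult_def)
qed

section \<open>The group\<close>

lemma mfps_nth_tuple_power_X:
  "mfps_nth (tuple_power (\<chi> i. mfps_X i) b) a =
     (if a = b then 1 else (0 :: 'a::comm_ring_1))"
  for a b :: "nat ^ 'n::finite"
proof -
  \<comment> \<open>The monomials with coefficient 1: sums of exponents become products, so each one
    can be assembled from powers of the variables.\<close>
  define M :: "nat ^ 'n \<Rightarrow> ('a, 'n) mfps" where "M b = Abs_mfps (\<lambda>a. if a = b then 1 else 0)" for b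
  have mult: "M b * M c = M (b + c)" for b c
  proof (rule mfps_eqI)
    fix a
    \<comment> \<open>Only the split \<open>(b, c)\<close> has nonzero coefficients in both factors,
      and it occurs exactly if \<open>b + c = a\<close>.\<close>
    have "mfps_nth (M b * M c) a =
        (\<Sum>p\<in>(if b + c = a then {(b, c)} else {}). mfps_nth (M b) (fst p) * mfps_nth (M c) (snd p))"
      unfolding mfps_nth_mult case_prod_unfold
      by (rule sum.mono_neutral_right)
        (use finite_decompositions [of a] in \<open>auto simp: M_def case_prod_unfold split: if_splits\<close>)
    then show "mfps_nth (M b * M c) a = mfps_nth (M (b + c)) a"
      by (auto simp: M_def)
  qed
  have M0: "M 0 = 1"
    by (rule mfps_eqI) (simp add: M_def)
  have "M (axis j 1) ^ k = M (axis j k)" for j k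
  proof (induction k)
    case (Suc k)
    have "axis j 1 + axis j k = axis j (Suc k)"
      by (auto simp: vec_eq_iff axis_def)
    with Suc show ?case
      by (simp add: mult del: One_nat_def)
  next
    case 0
    have "axis j 0 = (0 :: nat ^ 'n)"
      by (simp add: vec_eq_iff axis_def)
    then show ?case
      by (simp only: power_0 M0)
  qed
  moreover have "(\<Prod>j\<in>S. M (v j)) = M (\<Sum>j\<in>S. v j)" if "finite S" for S :: "'n set" and v
    using that by induction (auto simp: M0 mult)
  moreover have "(\<Sum>j\<in>UNIV. axis j (b $ j)) = b"
    by (simp add: vec_eq_iff axis_def)
  moreover have "mfps_X j = M (axis j 1)" for j
    by (simp add: mfps_X_def M_def)
  ultimately have "tuple_power (\<chi> i. mfps_X i) b = M b"
    by (simp add: tuple_power_def del: One_nat_def)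
  then show ?thesis
    by (simp add: M_def)
qed

lemma mfps_subst_X [simp]: "mfps_subst f (\<chi> i. mfps_X i) = f"
proof (rule mfps_eqI)
  fix a
  have "mfps_nth (mfps_subst f (\<chi> i. mfps_X i)) a =
      (\<Sum>b | mdeg b \<le> mdeg a. if a = b then mfps_nth f b else 0)"
    unfolding mfps_nth_subst mfps_nth_tuple_power_X by (rule sum.cong) auto
  then show "mfps_nth (mfps_subst f (\<chi> i. mfps_X i)) a = mfps_nth f a"
    by (simp add: finite_mdeg_le)
qed

text \<open>Substituting \<psi> does not change the lowest form of \<open>f\<close>, because each
  monomial and its value at \<psi> have the same lowest form. Hence the difference gains one
  degree.\<close>

lemma vanishes_below_subst_diff:
  assumes "no_constant \<psi>" "linear_matrix \<psi> = mat 1" "vanishes_below d f"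
  shows "vanishes_below (Suc d) (f - mfps_subst f \<psi>)"
  unfolding vanishes_below_def
proof (intro allI impI)
  fix a :: "nat ^ 'b"
  assume a: "mdeg a < Suc d"
  let ?X = "(\<chi> i. mfps_X i) :: ('a, 'b) mfps_tuple"
  have X: "no_constant ?X" "linear_matrix ?X = mat 1"
    by (simp_all flip: linear_tuple_one)
  have "vanishes_below 2 (?X $ i - \<psi> $ i)" for i
    unfolding vanishes_below_def
  proof (intro allI impI)
    fix b :: "nat ^ 'b"
    assume "mdeg b < 2"
    then consider "mdeg b < 1" | j where "b = axis j 1"
      using mdeg_eq_1_iff [of b] by (metis One_nat_def Suc_1 less_antisym)
    then show "mfps_nth (?X $ i - \<psi> $ i) b = 0"
    proof cases
      case 1
      then show ?thesis
        using X(1) assms(1) unfolding no_constant_def vanishes_below_def by simp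
    next
      case 2
      have "linear_matrix ?X $ i $ j = linear_matrix \<psi> $ i $ j"
        using X(2) assms(2) by simp
      then show ?thesis
        unfolding linear_matrix_def 2 by simp
    qed
  qed
  then have lead: "same_leading (mdeg b) (tuple_power ?X b) (tuple_power \<psi> b)" for b
    using X(1) assms(1) by (intro same_leading_tuple_power)
  \<comment> \<open>Below degree \<open>d\<close> the coefficient of \<open>f\<close> is zero;
    otherwise \<open>mdeg a \<le> mdeg b\<close>, a range in which the two powers agree.\<close>
  have "mfps_nth f b * mfps_nth (tuple_power ?X b) a = mfps_nth f b * mfps_nth (tuple_power \<psi> b) a" for b
  proof (cases "mdeg b < d")
    case True
    then show ?thesis
      using assms(3) by (simp add: vanishes_below_def)
  next
    case False
    then have "mdeg a < Suc (mdeg b)"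
      using a by simp
    then show ?thesis
      using lead [of b] by (simp add: same_leading_def vanishes_below_def)
  qed
  then have "mfps_nth (mfps_subst f ?X) a = mfps_nth (mfps_subst f \<psi>) a"
    by (simp only: mfps_nth_subst)
  then show "mfps_nth (f - mfps_subst f \<psi>) a = 0"
    by simp
qed

text \<open>For \<open>\<psi>\<close> tangent to the identity, substitution of \<open>\<psi>\<close> is a unipotent linear operator, so that
  it is inverted by successive approximation: each correction step improves the order of the
  error by one.\<close>

lemma mfps_subst_surj:
  fixes \<psi> :: "('a::comm_ring_1, 'n::finite) mfps_tuple"
  assumes "no_constant \<psi>" "linear_matrix \<psi> = mat 1"
  shows "\<exists>f. mfps_subst f \<psi> = g"
proof -
  \<comment> \<open>A fixed point of this iteration is a preimage of \<open>g\<close>.\<close>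
  define s where "s = rec_nat g (\<lambda>_ f. f + (g - mfps_subst f \<psi>))"
  have s_Suc: "s (Suc d) = s d + (g - mfps_subst (s d) \<psi>)" for d
    by (simp add: s_def)
  have err: "vanishes_below d (g - mfps_subst (s d) \<psi>)" for d
  proof (induction d)
    case (Suc d)
    \<comment> \<open>The new error is the old one minus its own substitution, so it vanishes one
      degree further.\<close>
    have "g - mfps_subst (s (Suc d)) \<psi> =
        (g - mfps_subst (s d) \<psi>) - mfps_subst (g - mfps_subst (s d) \<psi>) \<psi>"
      by (simp add: s_Suc mfps_subst_add)
    then show ?case
      using vanishes_below_subst_diff [OF assms Suc] by (simp only:)
  qed simp
  have stable: "vanishes_below d (s (d + k) - s d)" for d k
  proof (induction k)
    case (Suc k)
    have "vanishes_below d (g - mfps_subst (s (d + k)) \<psi>)"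
      using err [of "d + k"] by (rule vanishes_below_mono) simp
    moreover have "s (d + Suc k) - s d = (s (d + k) - s d) + (g - mfps_subst (s (d + k)) \<psi>)"
      by (simp add: s_Suc)
    ultimately show ?case
      using Suc by (simp only: vanishes_below_add)
  qed simp
  \<comment> \<open>The limit of the iterates. At \<open>a\<close> they are constant from index
    \<open>Suc (mdeg a)\<close> on, since \<open>stable\<close> controls only degrees strictly below
    its index.\<close>
  define f where "f = Abs_mfps (\<lambda>a. mfps_nth (s (Suc (mdeg a))) a)"
  have lim: "vanishes_below d (f - s d)" for d
    unfolding vanishes_below_def
  proof (intro allI impI)
    fix a :: "nat ^ 'n"
    assume "mdeg a < d"
    then have "mfps_nth (s d) a = mfps_nth (s (Suc (mdeg a))) a"
      using stable [of "Suc (mdeg a)" "d - Suc (mdeg a)"] by (simp add: vanishes_below_def)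
    then show "mfps_nth (f - s d) a = 0"
      by (simp add: f_def)
  qed
  have "mfps_subst f \<psi> = g"
  proof (rule mfps_eq_if_vanishes)
    fix d
    have "mfps_subst f \<psi> - g = mfps_subst (f - s d) \<psi> - (g - mfps_subst (s d) \<psi>)"
      by (simp add: mfps_subst_diff)
    then show "vanishes_below d (mfps_subst f \<psi> - g)"
      using vanishes_below_diff [OF vanishes_below_subst [OF assms(1) lim] err] by (simp only:)
  qed
  then show ?thesis ..
qed

lemma mfps_nth_subst_0: "mfps_nth (mfps_subst f \<psi>) 0 = mfps_nth f 0"
proof -
  have "{b :: nat ^ 'b. mdeg b \<le> mdeg (0 :: nat ^ 'b)} = {0}"
    by auto
  then show ?thesis
    by (simp add: mfps_nth_subst)
qed

lemma no_constant_iff: "no_constant \<phi> \<longleftrightarrow> (\<forall>i. mfps_nth (\<phi> $ i) 0 = 0)"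
  by (auto simp: no_constant_def vanishes_below_def)

text \<open>Preimages of the variables under substitution of \<psi> are the components of a left
  inverse; its linear part is read off from the composite.\<close>

lemma tuple_compose_left_inverse:
  fixes \<psi> :: "('a::comm_ring_1, 'n::finite) mfps_tuple"
  assumes "no_constant \<psi>" "linear_matrix \<psi> = mat 1"
  shows "\<exists>\<eta>. no_constant \<eta> \<and> linear_matrix \<eta> = mat 1 \<and>
    tuple_compose \<eta> \<psi> = linear_tuple (mat 1)"
proof -
  from mfps_subst_surj [OF assms] obtain F where F: "mfps_subst (F g) \<psi> = g" for g
    by metis
  define \<eta> :: "('a, 'n) mfps_tuple" where "\<eta> = (\<chi> i. F (mfps_X i))"
  have comp: "tuple_compose \<eta> \<psi> = linear_tuple (mat 1)"
    by (simp add: tuple_compose_def \<eta>_def F linear_tuple_one)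
  \<comment> \<open>Substitution keeps the constant term, and that of a variable is zero.\<close>
  have nc: "no_constant \<eta>"
    unfolding no_constant_iff
    using F mfps_nth_subst_0 [of "F (mfps_X _)" \<psi>]
    by (metis \<eta>_def comp no_constant_iff no_constant_linear_tuple linear_tuple_one vec_lambda_beta)
  have "linear_matrix \<eta> = mat 1"
    using linear_matrix_compose [OF nc assms(1)] assms(2) comp by simp
  with nc comp show ?thesis
    by blast
qed

section \<open>Carrier and group axioms\<close>

lemma carrier_G_infty_iff:
  "\<phi> \<in> carrier G_infty \<longleftrightarrow> no_constant \<phi> \<and> invertible (linear_matrix \<phi>)"
proof -
  have "homogeneous_part 0 \<phi> = 0 \<longleftrightarrow> no_constant \<phi>"
    unfolding no_constant_iff vec_eq_iff mfps_eq_iff homogeneous_part_def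
    by (auto simp: mdeg_eq_0_iff [unfolded vec_eq_iff] split: if_splits)
  then show ?thesis
    unfolding G_infty_def homogeneous_part_1 by simp
qed

lemma mult_G_infty [simp]: "\<phi> \<otimes>\<^bsub>G_infty\<^esub> \<psi> = tuple_compose \<phi> \<psi>"
  by (simp add: G_infty_def)

lemma one_G_infty [simp]: "\<one>\<^bsub>G_infty\<^esub> = linear_tuple (mat 1)"
  by (simp add: G_infty_def linear_tuple_one)

text \<open>\<open>groupI\<close> asks for left inverses only. Composing \<open>x\<close> on the
  left with the inverse \<open>B\<close> of its linear matrix makes it tangent to the identity; a
  left inverse \<eta> of the result, composed with \<open>B\<close>, inverts
  \<open>x\<close>.\<close>

lemma group_G_infty: "group (G_infty :: ('a::field, 'n::finite) mfps_tuple monoid)"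
proof (rule groupI)
  let ?G = "G_infty :: ('a, 'n) mfps_tuple monoid"
  fix x assume x: "x \<in> carrier ?G"
  then obtain B where B: "B ** linear_matrix x = mat 1" "linear_matrix x ** B = mat 1"
    by (auto simp: carrier_G_infty_iff invertible_def)
  have x0: "no_constant x"
    using x by (simp add: carrier_G_infty_iff)
  define \<psi> where "\<psi> = tuple_compose (linear_tuple B) x"
  have "no_constant \<psi>" "linear_matrix \<psi> = mat 1"
    using x0 B by (simp_all add: \<psi>_def no_constant_compose linear_matrix_compose)
  then obtain \<eta> where \<eta>: "no_constant \<eta>" "linear_matrix \<eta> = mat 1"
      "tuple_compose \<eta> \<psi> = linear_tuple (mat 1)"
    using tuple_compose_left_inverse by blast
  have "tuple_compose \<eta> (linear_tuple B) \<in> carrier ?G"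
    using \<eta> B by (auto simp: carrier_G_infty_iff no_constant_compose linear_matrix_compose invertible_def)
  moreover have "tuple_compose (tuple_compose \<eta> (linear_tuple B)) x = linear_tuple (mat 1)"
    using \<eta>(3) x0 by (simp add: tuple_compose_assoc \<psi>_def)
  ultimately show "\<exists>y\<in>carrier ?G. y \<otimes>\<^bsub>?G\<^esub> x = \<one>\<^bsub>?G\<^esub>"
    by auto
qed (auto simp: carrier_G_infty_iff no_constant_compose linear_matrix_compose invertible_mult
    tuple_compose_assoc linear_tuple_1_compose invertible_def [of "mat 1"] intro: exI [of _ "mat 1"])

section \<open>Averaging\<close>

lemma tuple_compose_sum_left:
  "tuple_compose (\<Sum>k\<in>S. u k) \<psi> = (\<Sum>k\<in>S. tuple_compose (u k) \<psi>)"
  by (simp add: tuple_compose_def vec_eq_iff mfps_subst_sum)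

lemma no_constant_sum: "(\<And>k. k \<in> S \<Longrightarrow> no_constant (u k)) \<Longrightarrow> no_constant (\<Sum>k\<in>S. u k)"
  by (simp add: no_constant_def vanishes_below_sum)

lemma linear_tuple_compose_sum:
  assumes "\<And>k. k \<in> S \<Longrightarrow> no_constant (u k)"
  shows "tuple_compose (linear_tuple A) (\<Sum>k\<in>S. u k) = (\<Sum>k\<in>S. tuple_compose (linear_tuple A) (u k))"
proof -
  have "(\<Sum>j\<in>UNIV. mfps_const (A $ i $ j) * (\<Sum>k\<in>S. u k $ j)) =
      (\<Sum>k\<in>S. \<Sum>j\<in>UNIV. mfps_const (A $ i $ j) * u k $ j)" for i
    unfolding sum_distrib_left by (rule sum.swap)
  then show ?thesis
    using assms by (simp add: linear_tuple_compose no_constant_sum vec_eq_iff)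
qed

lemma linear_matrix_sum: "linear_matrix (\<Sum>k\<in>S. u k) = (\<Sum>k\<in>S. linear_matrix (u k))"
  by (simp add: linear_matrix_def vec_eq_iff)

theorem corollary5:
  fixes \<phi> :: "(complex, 'n::finite) mfps_tuple"
  assumes "\<phi> \<in> carrier G_infty"
    and "periodic \<phi>"
  shows "conjugate_in G_infty \<phi> (homogeneous_part 1 \<phi>)"
proof -
  let ?G = "G_infty :: (complex, 'n) mfps_tuple monoid"
  interpret G: group ?G
    by (rule group_G_infty)
  define m where "m = G.ord \<phi>"
  have m: "m > 0" "\<phi> [^]\<^bsub>?G\<^esub> m = \<one>\<^bsub>?G\<^esub>"
    using assms by (auto simp: m_def periodic_def)
  \<comment> \<open>The linear part as an endomorphism of the group, so that it can be handled by
    group arithmetic.\<close>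
  define lin where "lin \<psi> = linear_tuple (linear_matrix \<psi>)" for \<psi> :: "(complex, 'n) mfps_tuple"
  have lin_closed [simp]: "lin \<psi> \<in> carrier ?G" if "\<psi> \<in> carrier ?G" for \<psi>
    using that by (simp add: lin_def carrier_G_infty_iff)
  have lin_mult: "lin (\<psi> \<otimes>\<^bsub>?G\<^esub> \<eta>) = lin \<psi> \<otimes>\<^bsub>?G\<^esub> lin \<eta>"
    if "\<psi> \<in> carrier ?G" "\<eta> \<in> carrier ?G" for \<psi> \<eta>
    using that by (simp add: lin_def carrier_G_infty_iff linear_matrix_compose linear_tuple_mult)
  have lin_pow: "lin (\<phi> [^]\<^bsub>?G\<^esub> k) = lin \<phi> [^]\<^bsub>?G\<^esub> k" for k :: nat
  proof (induction k)
    case (Suc k)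
    then show ?case
      using assms(1) lin_mult [of "\<phi> [^]\<^bsub>?G\<^esub> k" \<phi>] by (simp del: mult_G_infty)
  qed (simp add: lin_def)
  define l where "l = lin \<phi>"
  have l: "l \<in> carrier ?G"
    using assms(1) by (simp add: l_def)
  define u where "u k = inv\<^bsub>?G\<^esub> (l [^]\<^bsub>?G\<^esub> k) \<otimes>\<^bsub>?G\<^esub> \<phi> [^]\<^bsub>?G\<^esub> k" for k :: nat
  have u [simp]: "u k \<in> carrier ?G" for k
    using assms(1) l by (simp add: u_def del: mult_G_infty)
  then have nc: "no_constant (u k)" for k
    by (simp add: carrier_G_infty_iff)
  have lm_u: "linear_matrix (u k) = mat 1" for k
  proof -
    have "l [^]\<^bsub>?G\<^esub> k \<otimes>\<^bsub>?G\<^esub> u k = \<phi> [^]\<^bsub>?G\<^esub> k"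
      using assms(1) l by (simp add: u_def G.m_assoc [symmetric] del: mult_G_infty one_G_infty)
    then have "lin (l [^]\<^bsub>?G\<^esub> k) \<otimes>\<^bsub>?G\<^esub> lin (u k) = l [^]\<^bsub>?G\<^esub> k"
      using l lin_mult [of "l [^]\<^bsub>?G\<^esub> k" "u k"] lin_pow by (simp add: l_def del: mult_G_infty)
    \<comment> \<open>A power of \<open>l\<close> is itself a linear part, hence fixed by
      \<open>lin\<close>; cancelling it leaves the identity for \<open>lin (u k)\<close>.\<close>
    moreover have "lin (l [^]\<^bsub>?G\<^esub> k) = l [^]\<^bsub>?G\<^esub> k"
      unfolding l_def lin_pow [symmetric] by (simp add: lin_def)
    ultimately have "lin (u k) = \<one>\<^bsub>?G\<^esub>"
      using l by (metis G.r_cancel_one' G.l_cancel_one G.nat_pow_closed lin_closed u)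
    then show ?thesis
      by (metis lin_def linear_matrix_linear_tuple one_G_infty)
  qed
  have step: "u k \<otimes>\<^bsub>?G\<^esub> \<phi> = l \<otimes>\<^bsub>?G\<^esub> u (Suc k)" for k
  proof -
    \<comment> \<open>Powers grow on the right, so inversion puts the inverse of the new factor on
      the left, where \<open>l\<close> cancels it.\<close>
    have "inv\<^bsub>?G\<^esub> (l [^]\<^bsub>?G\<^esub> Suc k) = inv\<^bsub>?G\<^esub> l \<otimes>\<^bsub>?G\<^esub> inv\<^bsub>?G\<^esub> (l [^]\<^bsub>?G\<^esub> k)"
      using l by (simp add: G.inv_mult_group del: mult_G_infty)
    then have "l \<otimes>\<^bsub>?G\<^esub> inv\<^bsub>?G\<^esub> (l [^]\<^bsub>?G\<^esub> Suc k) = inv\<^bsub>?G\<^esub> (l [^]\<^bsub>?G\<^esub> k)"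
      using l by (simp add: G.m_assoc [symmetric] del: mult_G_infty one_G_infty G.nat_pow_Suc)
    then show ?thesis
      using l assms(1)
      unfolding u_def
      by (simp add: G.m_assoc [symmetric] del: mult_G_infty one_G_infty G.nat_pow_Suc)
  qed
  \<comment> \<open>Both are the identity, since \<open>lin\<close> carries the relation for the
    \<open>m\<close>-th power of \<phi> to \<open>l\<close>.\<close>
  have um: "u m = u 0"
    using m(2) lin_pow [of m] by (simp add: u_def l_def) (simp add: lin_def)
  define h where "h = (\<Sum>k<m. u k)"
  \<comment> \<open>A cyclic shift: both sums arise from the sum over \<open>k < Suc m\<close> by
    removing an end term, and the end terms \<open>u 0\<close> and \<open>u m\<close> agree.\<close>
  have "(\<Sum>k<m. u (Suc k)) = h"
    unfolding h_def using um sum.lessThan_Suc_shift [of u m] sum.lessThan_Suc [of u m] by simp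
  moreover have "tuple_compose h \<phi> = tuple_compose l (\<Sum>k<m. u (Suc k))"
    using step unfolding h_def l_def lin_def
    by (simp add: tuple_compose_sum_left linear_tuple_compose_sum nc)
  ultimately have conj: "h \<otimes>\<^bsub>?G\<^esub> \<phi> = l \<otimes>\<^bsub>?G\<^esub> h"
    by simp
  have "linear_matrix h = mat (of_nat m)"
    unfolding h_def linear_matrix_sum lm_u vec_eq_iff sum_component by (simp add: mat_def)
  \<comment> \<open>The determinant is a power of \<open>m\<close>, nonzero because
    \<open>m > 0\<close> in characteristic 0.\<close>
  then have "invertible (linear_matrix h)"
    using m(1) by (simp add: invertible_det_nz mat_def det_diagonal)
  then have h: "h \<in> carrier ?G"
    by (simp add: carrier_G_infty_iff h_def no_constant_sum nc)
  \<comment> \<open>Inserting the inverse of \<open>h\<close> times \<open>h\<close> in front of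
    \<phi> produces the product to which \<open>conj\<close> applies.\<close>
  have "\<phi> \<otimes>\<^bsub>?G\<^esub> inv\<^bsub>?G\<^esub> h = inv\<^bsub>?G\<^esub> h \<otimes>\<^bsub>?G\<^esub> (h \<otimes>\<^bsub>?G\<^esub> \<phi>) \<otimes>\<^bsub>?G\<^esub> inv\<^bsub>?G\<^esub> h"
    using h assms(1) by (simp add: G.m_assoc [symmetric] del: mult_G_infty one_G_infty)
  also have "\<dots> = inv\<^bsub>?G\<^esub> h \<otimes>\<^bsub>?G\<^esub> l"
    unfolding conj using h l by (simp add: G.m_assoc del: mult_G_infty one_G_infty)
  finally show ?thesis
    using assms(1) l h unfolding conjugate_in_def homogeneous_part_1 l_def lin_def
    by (auto simp del: mult_G_infty one_G_infty)
qed

end
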